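(* There is a $3$-connected non-complete planar graph which is not $7$-truncated-degree-choosable.
   Context: For a graph $G$ and a positive integer $k$, $G$ is $k$-truncated-degree-choosable if it is $f$-choosable for $f(v)=\min\{k,d_G(v)\}$, i.e., for every assignment of lists $L(v)$ of colours with $|L(v)|\ge \min\{k,d_G(v)\}$ for each vertex $v$, there is a proper colouring $\phi$ of $G$ with $\phi(v)\in L(v)$ for all $v$. *)

theory Defs
  imports "HOL-Analysis.Analysis" "Graph_Theory.Graph_Theory"
begin

text \<open>Finite simple graphs are the symmetric digraphs of the locale \<^locale>\<open>graph\<close>. Each
  undirected edge \<open>{u, v}\<close> is represented by the two opposite arcs \<open>(u, v)\<close> and \<open>(v, u)\<close>, so
  the degree of \<open>v\<close> is its \<^const>\<open>out_degree\<close>.\<close>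

definition edges :: "('a, 'b) pre_digraph \<Rightarrow> 'a set set" where
  "edges G = {{u, v} | u v. u \<rightarrow>\<^bsub>G\<^esub> v}"

definition k_connected :: "nat \<Rightarrow> ('a, 'b) pre_digraph \<Rightarrow> bool" where
  "k_connected k G \<longleftrightarrow> card (verts G) > k \<and>
     (\<forall>S \<subseteq> verts G. card S < k \<longrightarrow> Digraph_Component.connected (G \<restriction> (verts G - S)))"

definition complete_graph :: "('a, 'b) pre_digraph \<Rightarrow> bool" where
  "complete_graph G \<longleftrightarrow> (\<exists>n. complete_digraph n G)"

text \<open>A drawing puts vertex \<open>v\<close> at the point \<open>p v\<close> and edge \<open>e\<close> along the arc \<open>\<gamma> e\<close>; the interior
  of an arc contains no vertex and no point of any other arc. The arcs are indexed by undirected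
  edges, so that the two opposite arcs of the digraph are drawn only once.\<close>

definition plane_drawing ::
    "('a, 'b) pre_digraph \<Rightarrow> ('a \<Rightarrow> complex) \<Rightarrow> ('a set \<Rightarrow> real \<Rightarrow> complex) \<Rightarrow> bool" where
  "plane_drawing G p \<gamma> \<longleftrightarrow> inj_on p (verts G) \<and>
     (\<forall>e \<in> edges G. arc (\<gamma> e) \<and> {pathstart (\<gamma> e), pathfinish (\<gamma> e)} = p ` e \<and>
        (path_image (\<gamma> e) - p ` e) \<inter> p ` verts G = {}) \<and>
     (\<forall>e \<in> edges G. \<forall>e' \<in> edges G. e \<noteq> e' \<longrightarrow>
        (path_image (\<gamma> e) - p ` e) \<inter> path_image (\<gamma> e') = {})"

definition planar :: "('a, 'b) pre_digraph \<Rightarrow> bool" where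
  "planar G \<longleftrightarrow> (\<exists>p \<gamma>. plane_drawing G p \<gamma>)"

text \<open>Finitely many finite lists only involve finitely many colours, so natural numbers suffice
  as colours. Finiteness of the lists is explicit because \<^const>\<open>card\<close> is 0 on infinite sets.\<close>

definition choosable :: "('a, 'b) pre_digraph \<Rightarrow> ('a \<Rightarrow> nat) \<Rightarrow> bool" where
  "choosable G f \<longleftrightarrow>
     (\<forall>L :: 'a \<Rightarrow> nat set. (\<forall>v \<in> verts G. finite (L v) \<and> card (L v) \<ge> f v) \<longrightarrow>
        (\<exists>\<phi>. (\<forall>v \<in> verts G. \<phi> v \<in> L v) \<and> (\<forall>u v. u \<rightarrow>\<^bsub>G\<^esub> v \<longrightarrow> \<phi> u \<noteq> \<phi> v)))"

definition truncated_degree_choosable :: "nat \<Rightarrow> ('a, 'b) pre_digraph \<Rightarrow> bool" where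
  "truncated_degree_choosable k G \<longleftrightarrow> choosable G (\<lambda>v. min k (out_degree G v))"

end

theory Submission
  imports Defs
begin

text \<open>Two apices are joined to all vertices of a long path (the spine). In each triangle formed by
  an apex \<open>a\<close> and two consecutive spine vertices \<open>x\<close>, \<open>y\<close>, insert an outer vertex adjacent to
  \<open>a\<close>, \<open>x\<close>, \<open>y\<close> and an inner vertex adjacent to \<open>x\<close>, \<open>y\<close> and the outer vertex. If the inner
  vertex has a list \<open>P\<close> of size 3 and the outer vertex has the list \<open>P \<union> {c}\<close>, then \<open>x\<close> and \<open>y\<close>
  cannot both be coloured from \<open>P\<close> once \<open>a\<close> has colour \<open>c\<close>.

  The apices have disjoint lists of size 7, and each of the 49 pairs of apex colours is defeated by
  its own block of six spine vertices, whose lists consist of that pair and five further colours.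
  Between consecutive spine vertices there are two palettes, one on each side. They can be chosen
  so that 3 possible colours of one vertex leave only 2 for the next, 2 leave only 1, and 1 leaves
  none. Hence three colours of a central spine vertex are eliminated by going right, and the other
  two by going left.\<close>

section \<open>Edges, degrees and colourings\<close>

lemma edges_conv: "edges G = (\<lambda>(u, v). {u, v}) ` arcs_ends G"
  by (force simp: edges_def)

lemma (in wf_digraph) edges_subset_verts:
  assumes "e \<in> edges G"
  shows "e \<subseteq> verts G"
  using assms by (auto simp: edges_def dest: adj_in_verts)

lemma (in nomulti_digraph) out_degree_le_card:
  assumes "finite N" "\<And>w. v \<rightarrow>\<^bsub>G\<^esub> w \<Longrightarrow> w \<in> N"
  shows "out_degree G v \<le> card N"
  unfolding out_degree_def
proof (rule card_inj_on_le)
  show "inj_on (head G) (out_arcs G v)"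
    using no_multi_arcs by (auto simp: inj_on_def arc_to_ends_def)
  show "head G ` out_arcs G v \<subseteq> N"
    using assms(2) by (auto simp: arcs_ends_conv)
qed (rule assms(1))

lemma (in graph) complete_graph_iff:
  "complete_graph G \<longleftrightarrow> (\<forall>u \<in> verts G. \<forall>v \<in> verts G. u \<noteq> v \<longrightarrow> u \<rightarrow>\<^bsub>G\<^esub> v)"
  using graph_axioms
  by (auto simp: complete_graph_def complete_digraph_def dest: adj_in_verts adj_not_same)

definition list_colouring :: "('a, 'b) pre_digraph \<Rightarrow> ('a \<Rightarrow> 'c set) \<Rightarrow> ('a \<Rightarrow> 'c) \<Rightarrow> bool" where
  "list_colouring G L \<phi> \<longleftrightarrow>
     (\<forall>v \<in> verts G. \<phi> v \<in> L v) \<and> (\<forall>u v. u \<rightarrow>\<^bsub>G\<^esub> v \<longrightarrow> \<phi> u \<noteq> \<phi> v)"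

lemma choosable_iff_list_colouring:
  fixes G :: "('a, 'b) pre_digraph"
  shows "choosable G f \<longleftrightarrow>
    (\<forall>L :: 'a \<Rightarrow> nat set. (\<forall>v \<in> verts G. finite (L v) \<and> f v \<le> card (L v)) \<longrightarrow>
      (\<exists>\<phi>. list_colouring G L \<phi>))"
  by (simp add: choosable_def list_colouring_def)

section \<open>The underlying symmetric graph\<close>

lemma in_parcs_mk_symmetric_iff: "(u, v) \<in> parcs (mk_symmetric G) \<longleftrightarrow> u \<rightarrow>\<^bsub>G\<^esub> v \<or> v \<rightarrow>\<^bsub>G\<^esub> u"
  by (auto simp: parcs_mk_symmetric arcs_ends_conv)

lemma edges_mk_symmetric: "edges (mk_symmetric G) = edges G"
  unfolding edges_def with_proj_simps in_parcs_mk_symmetric_iff by (blast intro: insert_commute)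

lemma planar_mk_symmetric: "planar (mk_symmetric G) \<longleftrightarrow> planar G"
  by (simp add: planar_def plane_drawing_def edges_mk_symmetric)

lemma list_colouring_mk_symmetric:
  "list_colouring (mk_symmetric G) L \<phi> \<longleftrightarrow> list_colouring G L \<phi>"
  by (fastforce simp: list_colouring_def in_parcs_mk_symmetric_iff)

lemma (in digraph) graph_mk_symmetric: "graph (mk_symmetric G)"
proof -
  interpret S: pair_digraph "mk_symmetric G" ..
  show ?thesis
    using symmetric_mk_symmetric by (rule S.graphI)
qed

section \<open>Isomorphism invariance\<close>

context
  fixes G :: "('a, 'b) pre_digraph" and hom :: "('a, 'b, 'c, 'd) digraph_isomorphism"
  assumes hom: "pre_digraph.digraph_isomorphism G hom"
begin

interpretation wf_digraph G
  using hom by (simp add: pre_digraph.digraph_isomorphism_def)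

lemma dominates_app_iso_iff:
  assumes "u \<in> verts G" "v \<in> verts G"
  shows "iso_verts hom u \<rightarrow>\<^bsub>app_iso hom G\<^esub> iso_verts hom v \<longleftrightarrow> u \<rightarrow>\<^bsub>G\<^esub> v"
proof -
  have "u = u' \<and> v = v'" if "u' \<rightarrow>\<^bsub>G\<^esub> v'" "iso_verts hom u' = iso_verts hom u"
    "iso_verts hom v' = iso_verts hom v" for u' v'
    using assms hom that adj_in_verts[OF that(1)] by simp
  then show ?thesis
    using hom by (force simp: arcs_ends_app_iso_eq)
qed

lemma graph_app_iso:
  assumes "graph G"
  shows "graph (app_iso hom G)"
proof -
  interpret graph G by fact
  interpret H: fin_digraph "app_iso hom G"
    using hom by (rule fin_digraphI_app_iso)
  show ?thesis
  proof unfold_locales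
    show "tail (app_iso hom G) e \<noteq> head (app_iso hom G) e" if "e \<in> arcs (app_iso hom G)" for e
      using that hom no_loops by (auto simp: iso_verts_tail iso_verts_head)
    show "d = e" if "d \<in> arcs (app_iso hom G)" "e \<in> arcs (app_iso hom G)"
      "arc_to_ends (app_iso hom G) d = arc_to_ends (app_iso hom G) e" for d e
      using that hom no_multi_arcs by (auto simp: arc_to_ends_def iso_verts_tail iso_verts_head)
    show "symmetric (app_iso hom G)"
      using hom sym_arcs by (auto simp: symmetric_def sym_def arcs_ends_app_iso_eq)
  qed
qed

lemma app_iso_induce_subgraph:
  assumes "T \<subseteq> verts G"
  shows "app_iso hom (G \<restriction> T) = app_iso hom G \<restriction> (iso_verts hom ` T)"
proof -
  have mem_T: "v \<in> T \<longleftrightarrow> iso_verts hom v \<in> iso_verts hom ` T" if "v \<in> verts G" for v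
    using assms hom that by (auto simp: subset_eq)
  have "arcs (app_iso hom (G \<restriction> T)) = arcs (app_iso hom G \<restriction> (iso_verts hom ` T))"
    using hom by (auto simp: iso_verts_tail iso_verts_head mem_T)
  then show ?thesis
    by (simp add: app_iso_def induce_subgraph_def)
qed

lemma k_connected_app_iso:
  assumes "k_connected k G"
  shows "k_connected k (app_iso hom G)"
  unfolding k_connected_def
proof (intro conjI allI impI)
  show "k < card (verts (app_iso hom G))"
    using assms hom by (simp add: k_connected_def)
next
  fix S' assume S': "S' \<subseteq> verts (app_iso hom G)" "card S' < k"
  have inj: "inj_on (iso_verts hom) (verts G)"
    using hom by (rule digraph_isomorphism_inj_on_verts)
  obtain S where S: "S \<subseteq> verts G" "S' = iso_verts hom ` S"
    using S' by (auto simp: subset_image_iff)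
  then have "card S < k"
    using S' inj by (simp add: card_image inj_on_subset)
  then have "Digraph_Component.connected (G \<restriction> (verts G - S))"
    using assms S by (simp add: k_connected_def)
  moreover have "pre_digraph.digraph_isomorphism (G \<restriction> (verts G - S)) hom"
    using hom by (rule digraph_isomorphism_subgraphI) (simp add: subgraph_induce_subgraphI)
  ultimately have "Digraph_Component.connected (app_iso hom (G \<restriction> (verts G - S)))"
    by (intro wf_digraph.connectedI_app_iso) auto
  also have "app_iso hom (G \<restriction> (verts G - S)) = app_iso hom G \<restriction> (verts (app_iso hom G) - S')"
    using S inj by (simp add: app_iso_induce_subgraph inj_on_image_set_diff)
  finally show "Digraph_Component.connected (app_iso hom G \<restriction> (verts (app_iso hom G) - S'))" .
qed

lemma complete_graph_app_iso:
  assumes "graph G"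
  shows "complete_graph (app_iso hom G) \<longleftrightarrow> complete_graph G"
  using hom assms graph_app_iso[OF assms]
  by (simp add: graph.complete_graph_iff dominates_app_iso_iff)

lemma edges_app_iso: "edges (app_iso hom G) = (`) (iso_verts hom) ` edges G"
  using hom by (simp add: edges_conv arcs_ends_app_iso_eq image_image case_prod_beta)

lemma planar_app_iso:
  assumes "planar G"
  shows "planar (app_iso hom G)"
proof -
  let ?f = "iso_verts hom" and ?g = "iso_verts (inv_iso hom)"
  obtain p \<gamma> where drawing: "plane_drawing G p \<gamma>"
    using assms by (auto simp: planar_def)
  define q where "q = p \<circ> ?g"
  define \<delta> where "\<delta> e = \<gamma> (?g ` e)" for e
  have g_image: "?g ` ?f ` X = X" if "X \<subseteq> verts G" for X
    using hom that by (rule verts_app_inv_iso_subgraph)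
  then have q_image: "q ` ?f ` X = p ` X" if "X \<subseteq> verts G" for X
    using that by (simp only: q_def image_comp[symmetric])
  have "inj_on q (?f ` verts G)"
    using drawing hom by (auto simp: plane_drawing_def q_def inj_on_def)
  moreover have "q ` ?f ` e = p ` e" "\<delta> (?f ` e) = \<gamma> e" if "e \<in> edges G" for e
    using edges_subset_verts[OF that] g_image q_image by (simp_all add: \<delta>_def)
  ultimately have "plane_drawing (app_iso hom G) q \<delta>"
    using drawing q_image[OF subset_refl]
    by (simp add: plane_drawing_def edges_app_iso del: image_image) metis
  then show ?thesis
    by (auto simp: planar_def)
qed

lemma truncated_degree_choosable_app_isoD:
  assumes "truncated_degree_choosable k (app_iso hom G)"
  shows "truncated_degree_choosable k G"
  unfolding truncated_degree_choosable_def choosable_iff_list_colouring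
proof (intro allI impI)
  let ?f = "iso_verts hom" and ?g = "iso_verts (inv_iso hom)"
  fix L :: "'a \<Rightarrow> nat set"
  assume "\<forall>v \<in> verts G. finite (L v) \<and> min k (out_degree G v) \<le> card (L v)"
  then have "\<forall>v \<in> verts (app_iso hom G).
      finite (L (?g v)) \<and> min k (out_degree (app_iso hom G) v) \<le> card (L (?g v))"
    using hom by (simp add: out_degree_app_iso_eq)
  then obtain \<phi> where \<phi>: "list_colouring (app_iso hom G) (L \<circ> ?g) \<phi>"
    using assms by (fastforce simp: truncated_degree_choosable_def choosable_iff_list_colouring)
  then have "\<phi> (?f v) \<in> L v" if "v \<in> verts G" for v
    using hom that by (force simp: list_colouring_def)
  moreover have "\<phi> (?f u) \<noteq> \<phi> (?f v)" if "u \<rightarrow>\<^bsub>G\<^esub> v" for u v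
    using \<phi> that adj_in_verts[OF that] by (simp add: list_colouring_def dominates_app_iso_iff)
  ultimately have "list_colouring G L (\<phi> \<circ> ?f)"
    by (simp add: list_colouring_def)
  then show "\<exists>\<phi>. list_colouring G L \<phi>"
    by blast
qed

end

definition nat_iso :: "('a::countable, 'a \<times> 'a, nat, nat \<times> nat) digraph_isomorphism" where
  "nat_iso = \<lparr>iso_verts = to_nat, iso_arcs = map_prod to_nat to_nat, iso_head = snd, iso_tail = fst\<rparr>"

lemma digraph_isomorphism_nat_iso:
  fixes G :: "'a::countable pair_pre_digraph"
  assumes "pair_wf_digraph G"
  shows "pre_digraph.digraph_isomorphism (with_proj G) nat_iso"
  unfolding pre_digraph.digraph_isomorphism_def
  using assms by (auto simp: nat_iso_def inj_on_def wf_digraph_wp_iff)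

section \<open>Connectivity\<close>

lemma (in sym_digraph) connected_if_hub:
  assumes "h \<in> verts G" "\<And>v. v \<in> verts G \<Longrightarrow> v \<rightarrow>\<^sup>* h"
  shows "Digraph_Component.connected G"
proof (rule connectedI)
  show "verts G \<noteq> {}"
    using assms(1) by blast
  fix u v assume "u \<in> verts G" "v \<in> verts G"
  then have "u \<rightarrow>\<^sup>* v"
    using assms(2) by (meson reachable_trans symmetric_reachable')
  then show "u \<rightarrow>\<^sup>*\<^bsub>mk_symmetric G\<^esub> v"
    by (simp add: reachable_mk_symmetricI)
qed

lemma induce_subgraph_induce_subgraph:
  assumes "T \<subseteq> U"
  shows "(G \<restriction> U) \<restriction> T = G \<restriction> T"
  using assms by (auto simp: induce_subgraph_def)

lemma dominates_induce_subgraphI: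
  assumes "u \<rightarrow>\<^bsub>G\<^esub> v" "u \<in> T" "v \<in> T"
  shows "u \<rightarrow>\<^bsub>G \<restriction> T\<^esub> v"
  using assms by (auto simp: arcs_ends_conv)

lemma (in wf_digraph) induce_subgraph_verts_self: "G \<restriction> verts G = G"
  by (simp add: induce_subgraph_def cong: conj_cong)

lemma k_connected_induce_subgraph_iff:
  "k_connected k (G \<restriction> U) \<longleftrightarrow> k < card U \<and>
     (\<forall>S \<subseteq> U. card S < k \<longrightarrow> Digraph_Component.connected (G \<restriction> (U - S)))"
  by (simp add: k_connected_def induce_subgraph_induce_subgraph)

lemma (in sym_digraph) sym_digraph_induce_subgraph:
  assumes "T \<subseteq> verts G"
  shows "sym_digraph (G \<restriction> T)"
  using assms by (intro induced_graph_imp_graph induced_induce)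

lemma (in sym_digraph) connected_induce_subgraph_expand:
  assumes "U \<subseteq> W" "W \<subseteq> verts G" and connected: "Digraph_Component.connected (G \<restriction> U)"
    and neighbour: "\<And>v. v \<in> W - U \<Longrightarrow> \<exists>u \<in> U. v \<rightarrow>\<^bsub>G\<^esub> u"
  shows "Digraph_Component.connected (G \<restriction> W)"
proof -
  interpret U: sym_digraph "G \<restriction> U"
    using assms(1,2) by (intro sym_digraph_induce_subgraph) blast
  interpret W: sym_digraph "G \<restriction> W"
    using assms(2) by (rule sym_digraph_induce_subgraph)
  obtain h where h: "h \<in> U" "\<And>u. u \<in> U \<Longrightarrow> u \<rightarrow>\<^sup>*\<^bsub>G \<restriction> U\<^esub> h"
    using U.symmetric_connected_imp_strongly_connected[OF U.sym_arcs connected]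
    by (auto simp: strongly_connected_def)
  then have old: "u \<rightarrow>\<^sup>*\<^bsub>G \<restriction> W\<^esub> h" if "u \<in> U" for u
    using that assms(1) by (blast intro: reachable_induce_ss)
  have new: "v \<rightarrow>\<^sup>*\<^bsub>G \<restriction> W\<^esub> h" if v: "v \<in> W - U" for v
  proof -
    obtain u where u: "u \<in> U" "v \<rightarrow>\<^bsub>G\<^esub> u"
      using neighbour[OF v] by blast
    then have "v \<rightarrow>\<^bsub>G \<restriction> W\<^esub> u"
      using v assms(1) by (intro dominates_induce_subgraphI) auto
    with old[OF u(1)] show ?thesis
      by (rule W.adj_reachable_trans[rotated])
  qed
  show ?thesis
    using h(1) assms(1) old new by (intro W.connected_if_hub[of h]) auto
qed

lemma (in pseudo_graph) k_connected_induce_subgraph_expand: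
  assumes "U \<subseteq> W" "W \<subseteq> verts G" and connected: "k_connected k (G \<restriction> U)"
    and neighbours: "\<And>v. v \<in> W - U \<Longrightarrow> \<exists>N \<subseteq> U. k \<le> card N \<and> (\<forall>u \<in> N. v \<rightarrow>\<^bsub>G\<^esub> u)"
  shows "k_connected k (G \<restriction> W)"
  unfolding k_connected_induce_subgraph_iff
proof (intro conjI allI impI)
  have "finite W"
    using assms(2) by (simp add: finite_subset)
  then have "card U \<le> card W"
    using assms(1) by (simp add: card_mono)
  then show "k < card W"
    using connected by (simp add: k_connected_induce_subgraph_iff)
  fix S assume S: "S \<subseteq> W" "card S < k"
  then have "finite S"
    using \<open>finite W\<close> by (simp add: finite_subset)
  show "Digraph_Component.connected (G \<restriction> (W - S))"
  proof (rule connected_induce_subgraph_expand[of "U - S"])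
    have "card (S \<inter> U) \<le> card S"
      using \<open>finite S\<close> by (simp add: card_mono)
    then have "Digraph_Component.connected (G \<restriction> (U - S \<inter> U))"
      using connected S unfolding k_connected_induce_subgraph_iff by auto
    then show "Digraph_Component.connected (G \<restriction> (U - S))"
      by (simp add: Diff_Int)
  next
    fix v assume "v \<in> W - S - (U - S)"
    then obtain N where N: "N \<subseteq> U" "k \<le> card N" "\<forall>u \<in> N. v \<rightarrow>\<^bsub>G\<^esub> u"
      using neighbours[of v] by auto
    have "\<not> N \<subseteq> S"
      using N S \<open>finite S\<close> card_mono[of S N] by auto
    then show "\<exists>u \<in> U - S. v \<rightarrow>\<^bsub>G\<^esub> u"
      using N by blast
  qed (use assms in auto)
qed

section \<open>Plane drawings\<close>

lemma path_image_interiorE: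
  assumes "z \<in> path_image g - {pathstart g, pathfinish g}"
  obtains x where "0 < x" "x < 1" "z = g x"
proof -
  obtain x where "0 \<le> x" "x \<le> 1" "z = g x"
    using assms by (auto simp: path_image_def)
  moreover have "x \<noteq> 0" "x \<noteq> 1"
    using assms \<open>z = g x\<close> by (auto simp: pathstart_def pathfinish_def)
  ultimately show thesis
    using that[of x] by simp
qed

text \<open>The label recovers from a point of the drawing the vertex or edge on which it lies, so no
  two edges have to be compared.\<close>

lemma plane_drawing_if_labelled:
  fixes label :: "complex \<Rightarrow> 'a set"
  assumes "loopfree_digraph G"
    and label_vertex: "\<And>v. v \<in> verts G \<Longrightarrow> label (p v) = {v}"
    and arc: "\<And>e. e \<in> edges G \<Longrightarrow> arc (\<gamma> e)"
    and ends: "\<And>e. e \<in> edges G \<Longrightarrow> {pathstart (\<gamma> e), pathfinish (\<gamma> e)} = p ` e"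
    and label_edge: "\<And>e x. e \<in> edges G \<Longrightarrow> 0 < x \<Longrightarrow> x < 1 \<Longrightarrow> label (\<gamma> e x) = e"
  shows "plane_drawing G p \<gamma>"
proof -
  interpret G: loopfree_digraph G by fact
  have label_interior: "label z = e" if "e \<in> edges G" "z \<in> path_image (\<gamma> e) - p ` e" for e z
    using that label_edge ends by (metis path_image_interiorE)
  have not_singleton: "e \<noteq> {v}" if "e \<in> edges G" for e v
    using that by (auto simp: edges_def doubleton_eq_iff dest: G.adj_not_same)
  have not_vertex: "z \<notin> p ` verts G" if "e \<in> edges G" "z \<in> path_image (\<gamma> e) - p ` e" for e z
    using label_interior[OF that] label_vertex not_singleton[OF that(1)] by fastforce
  show ?thesis
    unfolding plane_drawing_def
  proof (intro conjI ballI impI)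
    show "inj_on p (verts G)"
      using label_vertex by (metis inj_onI singleton_inject)
  next
    fix e assume e: "e \<in> edges G"
    show "arc (\<gamma> e)" "{pathstart (\<gamma> e), pathfinish (\<gamma> e)} = p ` e"
      using arc[OF e] ends[OF e] by simp_all
    show "(path_image (\<gamma> e) - p ` e) \<inter> p ` verts G = {}"
      using not_vertex[OF e] by blast
  next
    fix e e' assume edges: "e \<in> edges G" "e' \<in> edges G" "e \<noteq> e'"
    have False if z: "z \<in> path_image (\<gamma> e) - p ` e" "z \<in> path_image (\<gamma> e')" for z
    proof -
      have "z \<notin> p ` e'"
        using not_vertex[OF edges(1) z(1)] G.edges_subset_verts[OF edges(2)] by blast
      then have "e = e'"
        using label_interior edges z by blast
      with edges show False by simp
    qed
    then show "(path_image (\<gamma> e) - p ` e) \<inter> path_image (\<gamma> e') = {}"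
      by blast
  qed
qed

lemma planar_if_labelled:
  fixes label :: "complex \<Rightarrow> 'a set"
  assumes "loopfree_digraph G"
    and "\<And>v. v \<in> verts G \<Longrightarrow> label (p v) = {v}"
    and arc: "\<And>u v. u \<rightarrow>\<^bsub>G\<^esub> v \<Longrightarrow> arc (g u v)"
    and ends: "\<And>u v. u \<rightarrow>\<^bsub>G\<^esub> v \<Longrightarrow> pathstart (g u v) = p u \<and> pathfinish (g u v) = p v"
    and label_arc: "\<And>u v x. u \<rightarrow>\<^bsub>G\<^esub> v \<Longrightarrow> 0 < x \<Longrightarrow> x < 1 \<Longrightarrow> label (g u v x) = {u, v}"
  shows "planar G"
proof -
  have "\<forall>e \<in> edges G. \<exists>u v. u \<rightarrow>\<^bsub>G\<^esub> v \<and> e = {u, v}"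
    by (auto simp: edges_def)
  then obtain s t where st: "\<forall>e \<in> edges G. s e \<rightarrow>\<^bsub>G\<^esub> t e \<and> e = {s e, t e}"
    by (auto dest!: bchoice)
  have "plane_drawing G p (\<lambda>e. g (s e) (t e))"
  proof (rule plane_drawing_if_labelled[where label = label])
    fix e assume "e \<in> edges G"
    then obtain u v where uv: "s e = u" "t e = v" "u \<rightarrow>\<^bsub>G\<^esub> v" "e = {u, v}"
      using st by blast
    show "arc (g (s e) (t e))" "{pathstart (g (s e) (t e)), pathfinish (g (s e) (t e))} = p ` e"
      using arc ends uv by auto
    show "label (g (s e) (t e) x) = e" if "0 < x" "x < 1" for x
      using label_arc uv that by auto
  qed (use assms in auto)
  then show ?thesis
    by (auto simp: planar_def)
qed

section \<open>The graph\<close>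

text \<open>The Boolean argument selects the apex; \<open>Outer s i\<close> and \<open>Inner s i\<close> lie in the triangle
  \<open>Apex s\<close>, \<open>Spine i\<close>, \<open>Spine (Suc i)\<close>.\<close>

datatype vtx = Apex bool | Spine nat | Outer bool nat | Inner bool nat

instance vtx :: countable
  by countable_datatype

definition strip_verts :: "nat \<Rightarrow> vtx set" where
  "strip_verts n = range Apex \<union> Spine ` {..<n} \<union>
     (\<Union>s. Outer s ` {..<n - 1}) \<union> (\<Union>s. Inner s ` {..<n - 1})"

inductive_set strip_arcs :: "nat \<Rightarrow> (vtx \<times> vtx) set" for n where
  spine: "Suc i < n \<Longrightarrow> (Spine i, Spine (Suc i)) \<in> strip_arcs n"
| spine_apex: "i < n \<Longrightarrow> (Spine i, Apex s) \<in> strip_arcs n"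
| outer_apex: "Suc i < n \<Longrightarrow> (Outer s i, Apex s) \<in> strip_arcs n"
| left_outer: "Suc i < n \<Longrightarrow> (Spine i, Outer s i) \<in> strip_arcs n"
| right_outer: "Suc i < n \<Longrightarrow> (Spine (Suc i), Outer s i) \<in> strip_arcs n"
| left_inner: "Suc i < n \<Longrightarrow> (Spine i, Inner s i) \<in> strip_arcs n"
| right_inner: "Suc i < n \<Longrightarrow> (Spine (Suc i), Inner s i) \<in> strip_arcs n"
| inner_outer: "Suc i < n \<Longrightarrow> (Inner s i, Outer s i) \<in> strip_arcs n"

definition strip_digraph :: "nat \<Rightarrow> vtx pair_pre_digraph" where
  "strip_digraph n = \<lparr>pverts = strip_verts n, parcs = strip_arcs n\<rparr>"

abbreviation strip_graph :: "nat \<Rightarrow> vtx pair_pre_digraph" where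
  "strip_graph n \<equiv> mk_symmetric (strip_digraph n)"

lemma strip_digraph_simps [simp]:
  "pverts (strip_digraph n) = strip_verts n"
  "parcs (strip_digraph n) = strip_arcs n"
  by (simp_all add: strip_digraph_def)

lemma in_parcs_strip_graph_iff [simp]:
  "(u, v) \<in> parcs (strip_graph n) \<longleftrightarrow> (u, v) \<in> strip_arcs n \<or> (v, u) \<in> strip_arcs n"
  by (simp add: in_parcs_mk_symmetric_iff)

lemma in_strip_verts_iff [simp]:
  "Apex s \<in> strip_verts n"
  "Spine i \<in> strip_verts n \<longleftrightarrow> i < n"
  "Outer s i \<in> strip_verts n \<longleftrightarrow> Suc i < n"
  "Inner s i \<in> strip_verts n \<longleftrightarrow> Suc i < n"
  by (auto simp: strip_verts_def image_iff less_diff_conv)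

lemma strip_arcs_subset: "strip_arcs n \<subseteq> strip_verts n \<times> strip_verts n"
  by (auto elim: strip_arcs.cases)

lemma pair_digraph_strip_digraph: "pair_digraph (strip_digraph n)"
proof
  show "finite (pverts (strip_digraph n))"
    by (simp add: strip_verts_def)
  then show "finite (parcs (strip_digraph n))"
    by (auto intro: finite_subset[OF strip_arcs_subset])
  fix e assume "e \<in> parcs (strip_digraph n)"
  then have "fst e \<in> strip_verts n \<and> snd e \<in> strip_verts n \<and> fst e \<noteq> snd e"
    by (cases e) (auto elim: strip_arcs.cases)
  then show "fst e \<in> pverts (strip_digraph n)" "snd e \<in> pverts (strip_digraph n)" "fst e \<noteq> snd e"
    by simp_all
qed

lemma graph_strip_graph: "graph (strip_graph n)"
proof -
  interpret pair_digraph "strip_digraph n"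
    by (rule pair_digraph_strip_digraph)
  show ?thesis
    by (rule graph_mk_symmetric)
qed

lemma not_complete_strip_graph: "\<not> complete_graph (strip_graph n)"
proof
  assume "complete_graph (strip_graph n)"
  then have "(Apex True, Apex False) \<in> parcs (strip_graph n)"
    using graph.complete_graph_iff[OF graph_strip_graph, of n] by simp
  then show False
    by (auto elim: strip_arcs.cases)
qed

lemma connected_spine:
  assumes "0 < n"
  shows "Digraph_Component.connected (strip_graph n \<restriction> (Spine ` {..<n}))"
proof -
  interpret graph "strip_graph n"
    by (rule graph_strip_graph)
  interpret T: sym_digraph "strip_graph n \<restriction> (Spine ` {..<n})"
    by (intro sym_digraph_induce_subgraph) auto
  have "Spine i \<rightarrow>\<^sup>*\<^bsub>strip_graph n \<restriction> (Spine ` {..<n})\<^esub> Spine 0" if "i < n" for i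
    using that
  proof (induction i)
    case 0
    then show ?case
      by (intro T.reachable_refl) simp
  next
    case (Suc i)
    have "Spine (Suc i) \<rightarrow>\<^bsub>strip_graph n \<restriction> (Spine ` {..<n})\<^esub> Spine i"
      using Suc.prems by (intro dominates_induce_subgraphI) (auto intro: spine)
    with Suc show ?case
      by (auto intro: T.adj_reachable_trans)
  qed
  then show ?thesis
    using assms by (intro T.connected_if_hub[of "Spine 0"]) auto
qed

lemma connected_spine_apex:
  assumes T: "T \<subseteq> range Apex \<union> Spine ` {..<n}"
    and apex: "Apex s \<in> T" and spine: "Spine i \<in> T"
  shows "Digraph_Component.connected (strip_graph n \<restriction> T)"
proof -
  interpret graph "strip_graph n"
    by (rule graph_strip_graph)
  interpret T: sym_digraph "strip_graph n \<restriction> T"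
    using T by (intro sym_digraph_induce_subgraph) auto
  have spine_apex_adj: "Spine j \<rightarrow>\<^bsub>strip_graph n \<restriction> T\<^esub> Apex r"
    if "Spine j \<in> T" "Apex r \<in> T" for j r
    using that T by (intro dominates_induce_subgraphI) (auto intro: spine_apex)
  have "Apex r \<rightarrow>\<^sup>*\<^bsub>strip_graph n \<restriction> T\<^esub> Apex s" if "Apex r \<in> T" for r
    using spine_apex_adj[OF spine that] spine_apex_adj[OF spine apex]
    by (meson T.reachable_adjI T.reachable_trans T.symmetric_reachable')
  then have "v \<rightarrow>\<^sup>*\<^bsub>strip_graph n \<restriction> T\<^esub> Apex s" if "v \<in> T" for v
    using T that spine_apex_adj apex by auto
  then show ?thesis
    using apex by (intro T.connected_if_hub[of "Apex s"]) simp_all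
qed

lemma k_connected_strip_core:
  assumes "3 \<le> n"
  shows "k_connected 3 (strip_graph n \<restriction> (range Apex \<union> Spine ` {..<n}))"
  unfolding k_connected_induce_subgraph_iff
proof (intro conjI allI impI)
  let ?core = "range Apex \<union> Spine ` {..<n}"
  have card_range_Apex: "card (range Apex) = 2" and card_Spine_image: "card (Spine ` {..<n}) = n"
    by (simp_all add: card_image inj_on_def)
  then have "card ?core = 2 + n"
    by (subst card_Un_disjoint) auto
  then show "3 < card ?core"
    using assms by simp
  fix S assume S: "S \<subseteq> ?core" "card S < 3"
  then have "finite S"
    by (auto intro: finite_subset)
  show "Digraph_Component.connected (strip_graph n \<restriction> (?core - S))"
  proof (cases "range Apex \<subseteq> S")
    case True
    then have "S = range Apex"
      using S(2) card_range_Apex \<open>finite S\<close> by (intro card_seteq[symmetric]) auto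
    then have "?core - S = Spine ` {..<n}"
      by auto
    with assms show ?thesis
      by (simp add: connected_spine)
  next
    case False
    moreover have "\<not> Spine ` {..<n} \<subseteq> S"
      using S(2) assms card_Spine_image card_mono[OF \<open>finite S\<close>, of "Spine ` {..<n}"] by auto
    ultimately obtain s i where "Apex s \<notin> S" "i < n" "Spine i \<notin> S"
      by blast
    then show ?thesis
      by (intro connected_spine_apex[of _ n s i]) auto
  qed
qed

lemma k_connected_strip_graph:
  assumes "3 \<le> n"
  shows "k_connected 3 (strip_graph n)"
proof -
  interpret graph "strip_graph n"
    by (rule graph_strip_graph)
  let ?core = "range Apex \<union> Spine ` {..<n}"
  let ?outer = "strip_verts n - (\<Union>s. range (Inner s))"
  have "k_connected 3 (strip_graph n \<restriction> ?outer)"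
  proof (rule k_connected_induce_subgraph_expand[of ?core])
    show "k_connected 3 (strip_graph n \<restriction> ?core)"
      using assms by (rule k_connected_strip_core)
    fix v assume "v \<in> ?outer - ?core"
    then obtain s i where v: "v = Outer s i" "Suc i < n"
      by (cases v) auto
    then show "\<exists>N \<subseteq> ?core. 3 \<le> card N \<and> (\<forall>u \<in> N. v \<rightarrow>\<^bsub>strip_graph n\<^esub> u)"
      by (intro exI[of _ "{Spine i, Spine (Suc i), Apex s}"]) (auto intro: strip_arcs.intros)
  qed auto
  then have "k_connected 3 (strip_graph n \<restriction> strip_verts n)"
  proof (rule k_connected_induce_subgraph_expand[rotated 2])
    fix v assume "v \<in> strip_verts n - ?outer"
    then obtain s i where v: "v = Inner s i" "Suc i < n"
      by (cases v) auto
    then show "\<exists>N \<subseteq> ?outer. 3 \<le> card N \<and> (\<forall>u \<in> N. v \<rightarrow>\<^bsub>strip_graph n\<^esub> u)"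
      by (intro exI[of _ "{Spine i, Spine (Suc i), Outer s i}"]) (auto intro: strip_arcs.intros)
  qed auto
  then show ?thesis
    using induce_subgraph_verts_self by simp
qed

section \<open>A plane drawing of the graph\<close>

text \<open>The apices are the points \<open>\<i>\<close> and \<open>-\<i>\<close>. Pinching contracts the horizontal lines at heights
  1 and -1 to them and is injective in between. In the coordinates \<open>(t, h)\<close> all edges are
  straight, and those ending in an apex are vertical.\<close>

definition pinch :: "real \<Rightarrow> real \<Rightarrow> complex" where
  "pinch t h = Complex (t * (1 - \<bar>h\<bar>)) h"

definition pinched_segment :: "real \<Rightarrow> real \<Rightarrow> real \<Rightarrow> real \<Rightarrow> real \<Rightarrow> complex" where
  "pinched_segment t h t' h' = (\<lambda>x. pinch (t + x * (t' - t)) (h + x * (h' - h)))"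

lemma pinch_eq_iff: "pinch t h = pinch t' h' \<longleftrightarrow> h = h' \<and> (\<bar>h\<bar> = 1 \<or> t = t')"
  by (auto simp: pinch_def complex_eq_iff)

lemma arc_pinched_segment:
  assumes "\<bar>h\<bar> \<noteq> 1" "t \<noteq> t' \<or> h \<noteq> h'"
  shows "arc (pinched_segment t h t' h')"
  unfolding arc_def path_def
proof
  show "continuous_on {0..1} (pinched_segment t h t' h')"
    unfolding pinched_segment_def pinch_def complex_eq_iff Complex_eq by (intro continuous_intros)
  show "inj_on (pinched_segment t h t' h') {0..1}"
  proof (rule inj_onI)
    fix x y
    assume "pinched_segment t h t' h' x = pinched_segment t h t' h' y"
    then have "x * (h' - h) = y * (h' - h)"
      "\<bar>h + x * (h' - h)\<bar> = 1 \<or> x * (t' - t) = y * (t' - t)"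
      by (auto simp: pinched_segment_def pinch_eq_iff)
    then show "x = y"
      using assms by (cases "h = h'") auto
  qed
qed

definition side :: "bool \<Rightarrow> real" where
  "side s = (if s then 1 else - 1)"

fun abscissa :: "vtx \<Rightarrow> real" where
  "abscissa (Apex s) = 0"
| "abscissa (Spine i) = i"
| "abscissa (Outer s i) = i + 1 / 2"
| "abscissa (Inner s i) = i + 1 / 2"

fun height :: "vtx \<Rightarrow> real" where
  "height (Apex s) = side s"
| "height (Spine i) = 0"
| "height (Outer s i) = side s / 2"
| "height (Inner s i) = side s / 4"

definition vertex_point :: "vtx \<Rightarrow> complex" where
  "vertex_point v = pinch (abscissa v) (height v)"

definition arc_curve :: "vtx \<Rightarrow> vtx \<Rightarrow> real \<Rightarrow> complex" where
  "arc_curve u v = pinched_segment (abscissa u) (height u)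
     (case v of Apex s \<Rightarrow> abscissa u | _ \<Rightarrow> abscissa v) (height v)"

text \<open>Here \<open>f\<close> and \<open>h\<close> are the coordinates relative to \<open>Spine i\<close>, with \<open>0 \<le> f < 1\<close>. The values at
  points outside the drawing are irrelevant.\<close>

definition cell_label :: "nat \<Rightarrow> real \<Rightarrow> real \<Rightarrow> vtx set" where
  "cell_label i f h = (let s = h > 0 in
     if h = 0 then (if f = 0 then {Spine i} else {Spine i, Spine (Suc i)})
     else if f = 0 then {Spine i, Apex s}
     else if f = 1 / 2 then
       (if \<bar>h\<bar> = 1 / 4 then {Inner s i}
        else if \<bar>h\<bar> = 1 / 2 then {Outer s i}
        else if \<bar>h\<bar> < 1 / 2 then {Inner s i, Outer s i}
        else {Outer s i, Apex s})
     else if f < 1 / 2 then {Spine i, if \<bar>h\<bar> = f then Outer s i else Inner s i}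
     else {Spine (Suc i), if \<bar>h\<bar> = 1 - f then Outer s i else Inner s i})"

definition label :: "complex \<Rightarrow> vtx set" where
  "label z = (let h = Im z; t = Re z / (1 - \<bar>h\<bar>) in
     if \<bar>h\<bar> = 1 then {Apex (h > 0)} else cell_label (nat \<lfloor>t\<rfloor>) (frac t) h)"

lemma label_pinch:
  assumes "t = real i + f" "0 \<le> f" "f < 1" "\<bar>h\<bar> \<noteq> 1"
  shows "label (pinch t h) = cell_label i f h"
proof -
  have "\<lfloor>t\<rfloor> = int i"
    using assms by (intro floor_unique) auto
  then show ?thesis
    using assms by (simp add: label_def pinch_def frac_def)
qed

lemma label_vertex_point: "label (vertex_point v) = {v}"
proof (cases v)
  case (Apex s)
  then show ?thesis
    by (simp add: vertex_point_def label_def pinch_def side_def)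
next
  case (Spine i)
  then show ?thesis
    by (simp add: vertex_point_def label_pinch[of _ i 0] cell_label_def)
next
  case (Outer s i)
  then show ?thesis
    by (simp add: vertex_point_def label_pinch[of _ i "1 / 2"] cell_label_def side_def)
next
  case (Inner s i)
  then show ?thesis
    by (simp add: vertex_point_def label_pinch[of _ i "1 / 2"] cell_label_def side_def)
qed

lemma label_arc_curve:
  assumes "(u, v) \<in> strip_arcs n" "0 < x" "x < 1"
  shows "label (arc_curve u v x) = {u, v}"
proof -
  note defs = arc_curve_def pinched_segment_def cell_label_def side_def
  show ?thesis
    using assms(1)
  proof cases
    case (spine i)
    then show ?thesis
      using assms by (simp add: defs label_pinch[of _ i x])
  next
    case (spine_apex i s)
    then show ?thesis
      using assms by (simp add: defs label_pinch[of _ i 0])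
  next
    case (outer_apex i s)
    then show ?thesis
      using assms by (simp add: defs label_pinch[of _ i "1 / 2"])
  next
    case (left_outer i s)
    then show ?thesis
      using assms by (simp add: defs label_pinch[of _ i "x / 2"])
  next
    case (right_outer i s)
    then show ?thesis
      using assms by (simp add: defs label_pinch[of _ i "1 - x / 2"])
  next
    case (left_inner i s)
    then show ?thesis
      using assms by (simp add: defs label_pinch[of _ i "x / 2"])
  next
    case (right_inner i s)
    then show ?thesis
      using assms by (simp add: defs label_pinch[of _ i "1 - x / 2"])
  next
    case (inner_outer i s)
    then show ?thesis
      using assms by (simp add: defs label_pinch[of _ i "1 / 2"])
  qed
qed

lemma planar_strip_graph: "planar (strip_graph n)"
  unfolding planar_mk_symmetric
proof (rule planar_if_labelled[where label = label and p = vertex_point and g = arc_curve])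
  interpret D: pair_digraph "strip_digraph n"
    by (rule pair_digraph_strip_digraph)
  show "loopfree_digraph (strip_digraph n)" ..
  show "label (vertex_point v) = {v}" for v
    by (rule label_vertex_point)
  fix u v assume "u \<rightarrow>\<^bsub>strip_digraph n\<^esub> v"
  then have uv: "(u, v) \<in> strip_arcs n"
    by simp
  then show "arc (arc_curve u v)"
    unfolding arc_curve_def by cases (auto intro!: arc_pinched_segment simp: side_def)
  show "pathstart (arc_curve u v) = vertex_point u \<and> pathfinish (arc_curve u v) = vertex_point v"
    using uv by cases (auto simp: arc_curve_def pinched_segment_def vertex_point_def
      pathstart_def pathfinish_def pinch_eq_iff side_def)
  show "label (arc_curve u v x) = {u, v}" if "0 < x" "x < 1" for x
    using uv that by (rule label_arc_curve)
qed

section \<open>A bad list assignment\<close>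

text \<open>Otherwise four pairwise adjacent vertices would have three colours.\<close>

lemma spine_colours_not_both_in_palette:
  assumes colouring: "list_colouring (strip_graph n) L \<phi>" and i: "Suc i < n"
    and inner: "L (Inner s i) = P" and outer: "L (Outer s i) = insert (\<phi> (Apex s)) P"
    and "finite P" "card P = 3"
  shows "\<not> (\<phi> (Spine i) \<in> P \<and> \<phi> (Spine (Suc i)) \<in> P)"
proof
  let ?K = "{Spine i, Spine (Suc i), Inner s i, Outer s i}"
  have list: "\<phi> v \<in> L v" if "v \<in> strip_verts n" for v
    using colouring that by (simp add: list_colouring_mk_symmetric list_colouring_def)
  have proper: "\<phi> u \<noteq> \<phi> v" if "(u, v) \<in> strip_arcs n" for u v
    using colouring that by (simp add: list_colouring_mk_symmetric list_colouring_def)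
  assume "\<phi> (Spine i) \<in> P \<and> \<phi> (Spine (Suc i)) \<in> P"
  moreover have "\<phi> (Inner s i) \<in> P"
    using list[of "Inner s i"] inner i by simp
  moreover have "\<phi> (Outer s i) \<in> P"
    using list[of "Outer s i"] proper[OF outer_apex, of i s] outer i by simp
  ultimately have "\<phi> ` ?K \<subseteq> P"
    by simp
  moreover have "inj_on \<phi> ?K"
    using proper[OF spine[OF i]] proper[OF left_outer[OF i, of s]]
      proper[OF right_outer[OF i, of s]] proper[OF left_inner[OF i, of s]]
      proper[OF right_inner[OF i, of s]] proper[OF inner_outer[OF i, of s]]
    by simp
  ultimately have "card ?K \<le> card P"
    using \<open>finite P\<close> by (intro card_inj_on_le)
  with \<open>card P = 3\<close> show False
    by simp
qed

text \<open>A block consists of six consecutive spine vertices; position \<open>j\<close> means the strip between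
  the \<open>j\<close>-th and the next spine vertex. Position 5 only links two blocks. Block
  \<open>k\<close> defeats the apex colours \<open>apex_colour True k\<close> and \<open>apex_colour False k\<close>; there are 49
  blocks, hence \<open>294 = 49 * 6\<close> spine vertices.\<close>

definition palette :: "bool \<Rightarrow> nat \<Rightarrow> nat set" where
  "palette s j = (if j = 2 then {0, 1, 2}
     else if j = 1 \<or> j = 3 then (if s then {0, 3, 4} else {1, 3, 4})
     else (if s then {0, 1, 2} else {2, 3, 4}))"

definition apex_colour :: "bool \<Rightarrow> nat \<Rightarrow> nat" where
  "apex_colour s k = (if s then 5 + k div 7 else 12 + k mod 7)"

fun strip_lists :: "vtx \<Rightarrow> nat set" where
  "strip_lists (Apex s) = (if s then {5..<12} else {12..<19})"
| "strip_lists (Spine i) = {apex_colour True (i div 6), apex_colour False (i div 6)} \<union> {..<5}"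
| "strip_lists (Outer s i) = insert (apex_colour s (i div 6)) (palette s (i mod 6))"
| "strip_lists (Inner s i) = palette s (i mod 6)"

lemma palette_simps [simp]: "finite (palette s j)" "card (palette s j) = 3"
  by (simp_all add: palette_def)

lemma apex_colour_notin_palette: "apex_colour s k \<notin> palette s' j"
  by (auto simp: apex_colour_def palette_def)

lemma strip_lists_large:
  assumes "v \<in> strip_verts 294"
  shows "finite (strip_lists v) \<and> min 7 (out_degree (strip_graph 294) v) \<le> card (strip_lists v)"
proof -
  interpret graph "strip_graph 294"
    by (rule graph_strip_graph)
  show ?thesis
  proof (cases v)
    case (Apex s)
    then show ?thesis by simp
  next
    case (Spine i)
    then have "i < 294"
      using assms by simp
    then have "5 \<le> apex_colour True (i div 6)" "apex_colour True (i div 6) < 12"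
      "12 \<le> apex_colour False (i div 6)"
      by (auto simp: apex_colour_def)
    then have "card (strip_lists v) = 7"
      using Spine by simp
    then show ?thesis
      using Spine by simp
  next
    case (Outer s i)
    have "out_degree (strip_graph 294) v \<le> card {Apex s, Spine i, Spine (Suc i), Inner s i}"
      using Outer by (intro out_degree_le_card) (auto elim: strip_arcs.cases)
    then show ?thesis
      using Outer by (simp add: apex_colour_notin_palette)
  next
    case (Inner s i)
    have "out_degree (strip_graph 294) v \<le> card {Spine i, Spine (Suc i), Outer s i}"
      using Inner by (intro out_degree_le_card) (auto elim: strip_arcs.cases)
    then show ?thesis
      using Inner by simp
  qed
qed

lemma no_block_colouring:
  fixes x :: "nat \<Rightarrow> nat"
  assumes range: "\<And>j. j < 6 \<Longrightarrow> x j \<in> {0, 1, 2, 3, 4}"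
    and palette: "\<And>j s. j < 5 \<Longrightarrow> \<not> (x j \<in> palette s j \<and> x (Suc j) \<in> palette s j)"
  shows False
proof -
  have "x 2 \<notin> {3, 4}"
  proof
    assume "x 2 \<in> {3, 4}"
    then have "x 1 = 2"
      using range[of 1] palette[of 1 True] palette[of 1 False]
      by (auto simp: palette_def numeral_2_eq_2)
    then show False
      using range[of 0] palette[of 0 True] palette[of 0 False] by (auto simp: palette_def)
  qed
  moreover have "x 2 \<notin> {0, 1, 2}"
  proof
    assume "x 2 \<in> {0, 1, 2}"
    then have "x 3 \<in> {3, 4}"
      using range[of 3] palette[of 2 True] by (auto simp: palette_def)
    then have "x 4 = 2"
      using range[of 4] palette[of 3 True] palette[of 3 False] by (auto simp: palette_def)
    then show False
      using range[of 5] palette[of 4 True] palette[of 4 False] by (auto simp: palette_def)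
  qed
  ultimately show False
    using range[of 2] by auto
qed

lemma no_strip_colouring: "\<not> list_colouring (strip_graph 294) strip_lists \<phi>"
proof
  assume colouring: "list_colouring (strip_graph 294) strip_lists \<phi>"
  then have list: "\<phi> v \<in> strip_lists v" if "v \<in> strip_verts 294" for v
    using that by (simp add: list_colouring_def)
  have proper: "\<phi> u \<noteq> \<phi> v" if "(u, v) \<in> strip_arcs 294" for u v
    using colouring that by (simp add: list_colouring_mk_symmetric list_colouring_def)
  obtain a b where ab: "\<phi> (Apex True) = 5 + a" "\<phi> (Apex False) = 12 + b" "a < 7" "b < 7"
    using list[of "Apex True"] list[of "Apex False"] by (auto simp: le_iff_add)
  define k where "k = 7 * a + b"
  have "k < 49" and apex: "\<phi> (Apex s) = apex_colour s k" for s
    using ab by (auto simp: k_def apex_colour_def)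
  show False
  proof (rule no_block_colouring[of "\<lambda>j. \<phi> (Spine (6 * k + j))"])
    fix j :: nat
    assume "j < 6"
    then have i: "6 * k + j < 294" "(6 * k + j) div 6 = k"
      using \<open>k < 49\<close> by auto
    have "\<phi> (Spine (6 * k + j)) \<noteq> apex_colour s k" for s
      using proper[OF spine_apex[OF i(1), of s]] apex by simp
    then show "\<phi> (Spine (6 * k + j)) \<in> {0, 1, 2, 3, 4}"
      using list[of "Spine (6 * k + j)"] i by auto
  next
    fix j :: nat and s
    assume "j < 5"
    then have i: "Suc (6 * k + j) < 294" "(6 * k + j) div 6 = k" "(6 * k + j) mod 6 = j"
      using \<open>k < 49\<close> by auto
    then show "\<not> (\<phi> (Spine (6 * k + j)) \<in> palette s j \<and>
        \<phi> (Spine (6 * k + Suc j)) \<in> palette s j)"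
      using spine_colours_not_both_in_palette[OF colouring i(1), of s "palette s j"] apex by simp
  qed
qed

lemma not_truncated_degree_choosable_strip_graph:
  "\<not> truncated_degree_choosable 7 (strip_graph 294)"
proof
  assume "truncated_degree_choosable 7 (strip_graph 294)"
  moreover have "\<forall>v \<in> verts (strip_graph 294).
      finite (strip_lists v) \<and> min 7 (out_degree (strip_graph 294) v) \<le> card (strip_lists v)"
    using strip_lists_large by simp
  ultimately have "\<exists>\<phi>. list_colouring (strip_graph 294) strip_lists \<phi>"
    unfolding truncated_degree_choosable_def choosable_iff_list_colouring by blast
  with no_strip_colouring show False
    by blast
qed

theorem theorem3:
  shows "\<exists>G :: (nat, nat \<times> nat) pre_digraph.
    graph G \<and> k_connected 3 G \<and> \<not> complete_graph G \<and> planar G \<and>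
    \<not> truncated_degree_choosable 7 G"
proof (intro exI conjI)
  let ?G = "strip_graph 294"
  have "wf_digraph ?G"
    using graph_strip_graph by (simp add: graph_def digraph_def fin_digraph_def)
  then have iso: "pre_digraph.digraph_isomorphism ?G nat_iso"
    by (intro digraph_isomorphism_nat_iso) (simp add: wf_digraph_wp_iff)
  show "graph (app_iso nat_iso ?G)"
    using iso graph_strip_graph by (rule graph_app_iso)
  show "k_connected 3 (app_iso nat_iso ?G)"
    using iso by (rule k_connected_app_iso) (simp add: k_connected_strip_graph)
  show "\<not> complete_graph (app_iso nat_iso ?G)"
    using complete_graph_app_iso[OF iso graph_strip_graph] not_complete_strip_graph by simp
  show "planar (app_iso nat_iso ?G)"
    using iso planar_strip_graph by (rule planar_app_iso)
  show "\<not> truncated_degree_choosable 7 (app_iso nat_iso ?G)"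
    using truncated_degree_choosable_app_isoD[OF iso] not_truncated_degree_choosable_strip_graph
    by blast
qed

end
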